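(* Let $(\alpha^1,\alpha^2,\alpha^3)$ be the (right-invariant) Maurer–Cartan forms of $SU(2)$. Then the coframing $$\omega^1=\alpha^1,\qquad \omega^2=df-\alpha^3,\qquad \omega^3=\alpha^2$$ is an $(I,J,1)$-generalized Finsler structure, with invariants $I=f_{\alpha 1}$, $J=f_{\alpha 2}$, that descends to $SU(2)/\mathcal{C}_m$, where $f:SU(2)\to\mathbb{R}$ is a smooth function such that - $f(a_1,b_0,b_1)=\Phi\Bigl(b_0^2+b_1^2,\ \arctan\dfrac{a_0b_0+a_1b_1}{a_0b_1-a_1b_0}\Bigr)$, for $m=2$, and - $f(a_1,b_0,b_1)=\Phi(b_0^2+b_1^2)$, for $m>2$, where $\Phi$ is an arbitrary function of two variables, respectively one variable.
   Context: $SU(2)$ is identified with the unit quaternions $g=a_0+ia_1+jb_0+kb_1$, $a_0^2+a_1^2+b_0^2+b_1^2=1$; $(a_1,b_0,b_1)$ are used as local coordinates, with $a_0=\sqrt{1-a_1^2-b_0^2-b_1^2}$. The Maurer–Cartan forms (from $dg\cdot g^{-1}$) are the restrictions to $\mathbb{S}^3$ of $$\alpha^1=2(-b_0da_0+b_1da_1+a_0db_0-a_1db_1),\quad \alpha^2=2(-b_1da_0-b_0da_1+a_1db_0+a_0db_1),\quad \alpha^3=2(-a_1da_0+a_0da_1-b_1db_0+b_0db_1),$$ which satisfy $d\alpha^1=\alpha^2\wedge\alpha^3$, $d\alpha^2=\alpha^3\wedge\alpha^1$, $d\alpha^3=\alpha^1\wedge\alpha^2$. Directional derivatives are defined by $df=f_{\alpha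 1}\alpha^1+f_{\alpha 2}\alpha^2+f_{\alpha 3}\alpha^3$. $\mathcal{C}_m\subset SU(2)$ is the cyclic group of order $m$ generated by $x=\cos\frac{2\pi}{m}+i\sin\frac{2\pi}{m}$; it acts on $SU(2)$ by $g\mapsto g\cdot x$, and "descends" means the coframing is invariant under this action. An $(I,J,1)$-generalized Finsler structure is a coframe $(\omega^1,\omega^2,\omega^3)$ with $$d\omega^1=-I\,\omega^1\wedge\omega^3+\omega^2\wedge\omega^3,\quad d\omega^2=-\omega^1\wedge\omega^3,\quad d\omega^3=\omega^1\wedge\omega^2-J\,\omega^1\wedge\omega^3.$$ *)

theory Defs
  imports "HOL-Analysis.Analysis" "HOL-Algebra.Generated_Groups"
begin

section \<open>The group SU(2) of unit quaternions\<close>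

text \<open>The quaternion a0 + i a1 + j b0 + k b1 is the vector (a0, a1, b0, b1).\<close>

type_synonym quat = "real ^ 4"

abbreviation a0 :: "quat \<Rightarrow> real" where "a0 g \<equiv> g $ 1"
abbreviation a1 :: "quat \<Rightarrow> real" where "a1 g \<equiv> g $ 2"
abbreviation b0 :: "quat \<Rightarrow> real" where "b0 g \<equiv> g $ 3"
abbreviation b1 :: "quat \<Rightarrow> real" where "b1 g \<equiv> g $ 4"

definition qmul :: "quat \<Rightarrow> quat \<Rightarrow> quat" where
  "qmul p q = vector
    [a0 p * a0 q - a1 p * a1 q - b0 p * b0 q - b1 p * b1 q,
     a0 p * a1 q + a1 p * a0 q + b0 p * b1 q - b1 p * b0 q,
     a0 p * b0 q - a1 p * b1 q + b0 p * a0 q + b1 p * a1 q,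
     a0 p * b1 q + a1 p * b0 q - b0 p * a1 q + b1 p * a0 q]"

definition qcnj :: "quat \<Rightarrow> quat" where
  "qcnj q = vector [a0 q, - a1 q, - b0 q, - b1 q]"

abbreviation S3 :: "quat set" where "S3 \<equiv> sphere 0 1"

definition SU2 :: "quat monoid" where
  "SU2 = \<lparr>carrier = S3, mult = qmul, one = vector [1, 0, 0, 0]\<rparr>"

definition cyc_gen :: "nat \<Rightarrow> quat" where
  "cyc_gen m = vector [cos (2 * pi / real m), sin (2 * pi / real m), 0, 0]"

definition Cyc :: "nat \<Rightarrow> quat set" where
  "Cyc m = generate SU2 {cyc_gen m}"

section \<open>Smooth functions and differential forms on the three-sphere\<close>

text \<open>C^k and smooth functions on an open set \<open>S\<close>.\<close>

primrec Ck_on :: "nat \<Rightarrow> ('a::euclidean_space \<Rightarrow> real) \<Rightarrow> 'a set \<Rightarrow> bool" where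
  "Ck_on 0 f S = continuous_on S f"
| "Ck_on (Suc k) f S =
     (f differentiable_on S \<and> (\<forall>v. Ck_on k (\<lambda>x. frechet_derivative f (at x) v) S))"

definition smooth_on :: "('a::euclidean_space \<Rightarrow> real) \<Rightarrow> 'a set \<Rightarrow> bool" where
  "smooth_on f S \<longleftrightarrow> (\<forall>k. Ck_on k f S)"

definition tangent :: "quat \<Rightarrow> quat set" where
  "tangent g = {v. v \<bullet> g = 0}"

text \<open>
  A 1-form is a function \<open>\<omega> g v\<close> and a 2-form a function \<open>\<eta> g v w\<close>. For a form on the sphere only
  the values at \<open>g \<in> S3\<close> on vectors of \<open>tangent g\<close> are meaningful; the others are junk.
\<close>

type_synonym form1 = "quat \<Rightarrow> quat \<Rightarrow> real"
type_synonym form2 = "quat \<Rightarrow> quat \<Rightarrow> quat \<Rightarrow> real"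

definition pullback :: "(quat \<Rightarrow> quat) \<Rightarrow> form1 \<Rightarrow> form1" where
  "pullback \<phi> \<omega> = (\<lambda>x v. \<omega> (\<phi> x) (frechet_derivative \<phi> (at x) v))"

definition wedge :: "form1 \<Rightarrow> form1 \<Rightarrow> form2" where
  "wedge \<omega> \<eta> = (\<lambda>x v w. \<omega> x v * \<eta> x w - \<omega> x w * \<eta> x v)"

text \<open>
  Smoothness and exterior derivatives on the sphere are taken through the smooth retraction
  \<open>sgn x = x / norm x\<close> of \<open>- {0}\<close> onto \<open>S3\<close>: a function or 1-form on the sphere is smooth iff its
  pullback along \<open>sgn\<close> is, and, as the exterior derivative commutes with restriction to the
  sphere, the intrinsic d is the Euclidean d of this pullback, restricted to tangent vectors.
\<close>

definition smooth_fun_S3 :: "(quat \<Rightarrow> real) \<Rightarrow> bool" where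
  "smooth_fun_S3 f \<longleftrightarrow> smooth_on (\<lambda>x. f (sgn x)) (- {0})"

definition smooth_form_S3 :: "form1 \<Rightarrow> bool" where
  "smooth_form_S3 \<omega> \<longleftrightarrow>
     (\<forall>g\<in>S3. \<forall>v\<in>tangent g. \<forall>w\<in>tangent g. \<forall>r s. \<omega> g (r *\<^sub>R v + s *\<^sub>R w) = r * \<omega> g v + s * \<omega> g w) \<and>
     (\<forall>v. smooth_on (\<lambda>x. pullback sgn \<omega> x v) (- {0}))"

definition d0 :: "(quat \<Rightarrow> real) \<Rightarrow> form1" where
  "d0 f = (\<lambda>g v. frechet_derivative (\<lambda>x. f (sgn x)) (at g) v)"

definition d1 :: "form1 \<Rightarrow> form2" where
  "d1 \<omega> = (\<lambda>g v w. frechet_derivative (\<lambda>x. pullback sgn \<omega> x w) (at g) v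
                - frechet_derivative (\<lambda>x. pullback sgn \<omega> x v) (at g) w)"

definition eq_form2_S3 :: "form2 \<Rightarrow> form2 \<Rightarrow> bool" where
  "eq_form2_S3 \<eta> \<theta> \<longleftrightarrow> (\<forall>g\<in>S3. \<forall>v\<in>tangent g. \<forall>w\<in>tangent g. \<eta> g v w = \<theta> g v w)"

definition coframe_S3 :: "form1 \<Rightarrow> form1 \<Rightarrow> form1 \<Rightarrow> bool" where
  "coframe_S3 \<omega>1 \<omega>2 \<omega>3 \<longleftrightarrow>
     smooth_form_S3 \<omega>1 \<and> smooth_form_S3 \<omega>2 \<and> smooth_form_S3 \<omega>3 \<and>
     (\<forall>g\<in>S3. \<forall>c1 c2 c3. (\<forall>v\<in>tangent g. c1 * \<omega>1 g v + c2 * \<omega>2 g v + c3 * \<omega>3 g v = 0)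
        \<longrightarrow> c1 = 0 \<and> c2 = 0 \<and> c3 = 0)"

definition gen_finsler_S3 ::
    "(quat \<Rightarrow> real) \<Rightarrow> (quat \<Rightarrow> real) \<Rightarrow> form1 \<Rightarrow> form1 \<Rightarrow> form1 \<Rightarrow> bool" where
  "gen_finsler_S3 I J \<omega>1 \<omega>2 \<omega>3 \<longleftrightarrow>
     coframe_S3 \<omega>1 \<omega>2 \<omega>3 \<and>
     eq_form2_S3 (d1 \<omega>1) (\<lambda>g v w. - I g * wedge \<omega>1 \<omega>3 g v w + wedge \<omega>2 \<omega>3 g v w) \<and>
     eq_form2_S3 (d1 \<omega>2) (\<lambda>g v w. - wedge \<omega>1 \<omega>3 g v w) \<and>
     eq_form2_S3 (d1 \<omega>3) (\<lambda>g v w. wedge \<omega>1 \<omega>2 g v w - J g * wedge \<omega>1 \<omega>3 g v w)"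

text \<open>Invariance under the right translations \<open>g \<mapsto> g h\<close> with \<open>h\<close> in \<open>H\<close>.\<close>

definition right_invariant_under :: "quat set \<Rightarrow> form1 \<Rightarrow> bool" where
  "right_invariant_under H \<omega> \<longleftrightarrow>
     (\<forall>h\<in>H. \<forall>g\<in>S3. \<forall>v\<in>tangent g. pullback (\<lambda>g. qmul g h) \<omega> g v = \<omega> g v)"

definition descends_mod_Cyc :: "nat \<Rightarrow> form1 \<Rightarrow> form1 \<Rightarrow> form1 \<Rightarrow> bool" where
  "descends_mod_Cyc m \<omega>1 \<omega>2 \<omega>3 \<longleftrightarrow>
     right_invariant_under (Cyc m) \<omega>1 \<and> right_invariant_under (Cyc m) \<omega>2 \<and>
     right_invariant_under (Cyc m) \<omega>3"

section \<open>Maurer--Cartan forms\<close>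

text \<open>The differentials da0, da1, db0, db1 evaluate on \<open>v\<close> to \<open>a0 v\<close>, \<open>a1 v\<close>, \<open>b0 v\<close>, \<open>b1 v\<close>.\<close>

definition \<alpha>1 :: form1 where
  "\<alpha>1 g v = 2 * (- b0 g * a0 v + b1 g * a1 v + a0 g * b0 v - a1 g * b1 v)"

definition \<alpha>2 :: form1 where
  "\<alpha>2 g v = 2 * (- b1 g * a0 v - b0 g * a1 v + a1 g * b0 v + a0 g * b1 v)"

definition \<alpha>3 :: form1 where
  "\<alpha>3 g v = 2 * (- a1 g * a0 v + a0 g * a1 v - b1 g * b0 v + b0 g * b1 v)"

text \<open>
  The directional derivatives of \<open>f\<close>: the unique coefficients with
  df = \<open>f_\<alpha>1 \<alpha>1 + f_\<alpha>2 \<alpha>2 + f_\<alpha>3 \<alpha>3\<close> at \<open>g\<close>.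
\<close>

definition alpha_deriv :: "(quat \<Rightarrow> real) \<Rightarrow> quat \<Rightarrow> real ^ 3" where
  "alpha_deriv f g = (THE c. \<forall>v\<in>tangent g.
      d0 f g v = c $ 1 * \<alpha>1 g v + c $ 2 * \<alpha>2 g v + c $ 3 * \<alpha>3 g v)"

definition f_\<alpha>1 :: "(quat \<Rightarrow> real) \<Rightarrow> quat \<Rightarrow> real" where "f_\<alpha>1 f g = alpha_deriv f g $ 1"
definition f_\<alpha>2 :: "(quat \<Rightarrow> real) \<Rightarrow> quat \<Rightarrow> real" where "f_\<alpha>2 f g = alpha_deriv f g $ 2"

lemma vector_4 [simp]:
  fixes x y z w :: "'a::zero"
  shows "vector [x, y, z, w] $ (1::4) = x" "vector [x, y, z, w] $ (2::4) = y"
    "vector [x, y, z, w] $ (3::4) = z" "vector [x, y, z, w] $ (4::4) = w"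
  unfolding vector_def by simp_all

text \<open>\<open>\<alpha>3\<close>, \<open>\<alpha>1\<close>, \<open>\<alpha>2\<close> are twice the i, j, k components of \<open>dg g\<^sup>-\<^sup>1\<close>; the real one vanishes.\<close>

lemma maurer_cartan_components:
  shows "2 * a1 (qmul v (qcnj g)) = \<alpha>3 g v" "2 * b0 (qmul v (qcnj g)) = \<alpha>1 g v"
    "2 * b1 (qmul v (qcnj g)) = \<alpha>2 g v" "v \<in> tangent g \<Longrightarrow> a0 (qmul v (qcnj g)) = 0"
  by (simp_all add: qmul_def qcnj_def \<alpha>1_def \<alpha>2_def \<alpha>3_def tangent_def inner_vec_def sum_4
      algebra_simps)

end

theory Submission
  imports Defs
begin

text \<open>
  Write df = \<open>f_\<alpha>1 \<alpha>1 + f_\<alpha>2 \<alpha>2 + f_\<alpha>3 \<alpha>3\<close>. By the Maurer--Cartan equations and d(df) = 0, the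
  structure equations of the coframe \<open>\<alpha>1\<close>, df - \<open>\<alpha>3\<close>, \<open>\<alpha>2\<close> hold as soon as \<open>f_\<alpha>3\<close> = 0, that is, as
  soon as f is invariant under the left multiplications by exp(i t), up to speed the flow dual to \<open>\<alpha>3\<close>. In terms
  of z = a0 + i a1 and w = b0 + i b1, g = z + w j, this flow multiplies both z and w by exp(i t), so it
  preserves \<open>|w|\<^sup>2\<close> and \<open>z w\<^sup>*\<close>, of which f is a function. The right multiplication by
  exp(i s) maps z to exp(i s) z and w to exp(-i s) w: it always preserves \<open>|w|\<^sup>2\<close>, and for s = pi it
  preserves \<open>z w\<^sup>*\<close> too. As the \<open>\<alpha>i\<close> are right-invariant, the coframe descends. For m = 2 the
  formula for f holds on a dense subset of the sphere, and the invariance extends by continuity.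
\<close>

subsection \<open>Calculus of smooth functions\<close>

lemma Ck_on_SucD:
  assumes "Ck_on (Suc k) f S" "open S" "x \<in> S"
  shows "(f has_derivative frechet_derivative f (at x)) (at x)"
proof -
  have "f differentiable_on S" using assms(1) by simp
  then have "f differentiable (at x)"
    using assms by (simp add: differentiable_on_eq_differentiable_at)
  then show ?thesis by (simp add: frechet_derivative_works)
qed

lemma Ck_on_cong:
  assumes "open S" "Ck_on k f S" "\<And>x. x \<in> S \<Longrightarrow> f x = g x"
  shows "Ck_on k g S"
  using assms(2,3)
proof (induction k arbitrary: f g)
  case 0
  then show ?case by (simp cong: continuous_on_cong)
next
  case (Suc k)
  have der: "(g has_derivative frechet_derivative f (at x)) (at x)" if "x \<in> S" for x
    using Ck_on_SucD[OF Suc.prems(1) assms(1) that] assms(1) that Suc.prems(2)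
    by (rule has_derivative_transform_within_open) auto
  have "g differentiable_on S"
    using der assms(1) by (auto simp: differentiable_on_eq_differentiable_at differentiable_def)
  moreover have "Ck_on k (\<lambda>x. frechet_derivative g (at x) v) S" for v
  proof (rule Suc.IH)
    show "Ck_on k (\<lambda>x. frechet_derivative f (at x) v) S" using Suc.prems(1) by simp
    show "frechet_derivative f (at x) v = frechet_derivative g (at x) v" if "x \<in> S" for x
      using frechet_derivative_at[OF der[OF that]] by simp
  qed
  ultimately show ?case by simp
qed

text \<open>Derivatives are unique, so an explicit formula \<open>f'\<close> may stand in for
  \<open>frechet_derivative\<close>; this is how sums, products and inverses are treated
  below.\<close>

lemma Ck_on_SucI:
  assumes "open S" "\<And>x. x \<in> S \<Longrightarrow> (f has_derivative f' x) (at x)"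
    and "\<And>v. Ck_on k (\<lambda>x. f' x v) S"
  shows "Ck_on (Suc k) f S"
proof -
  have "f differentiable_on S"
    using assms(1,2) by (auto simp: differentiable_on_eq_differentiable_at differentiable_def)
  moreover have "Ck_on k (\<lambda>x. frechet_derivative f (at x) v) S" for v
    using assms(1) assms(3)[of v] by (rule Ck_on_cong) (use frechet_derivative_at[OF assms(2)] in simp)
  ultimately show ?thesis by simp
qed

lemma Ck_on_Suc_imp: "Ck_on (Suc k) f S \<Longrightarrow> Ck_on k f S"
proof (induction k arbitrary: f)
  case 0
  then show ?case by (simp add: differentiable_imp_continuous_on)
next
  case (Suc k)
  \<comment> \<open>Only the outer successor is unfolded, which keeps the derivatives in the form
    \<open>Ck_on (Suc k)\<close> that the induction hypothesis takes.\<close>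
  then have "f differentiable_on S" "\<And>v. Ck_on (Suc k) (\<lambda>x. frechet_derivative f (at x) v) S"
    by (simp_all only: Ck_on.simps(2)[of "Suc k"])
  then show ?case using Suc.IH by simp
qed

lemma Ck_on_const: "open S \<Longrightarrow> Ck_on k (\<lambda>x. c) S"
proof (induction k arbitrary: c)
  case (Suc k)
  show ?case by (rule Ck_on_SucI[where f' = "\<lambda>x v. 0"]) (auto intro: Suc)
qed simp

lemma Ck_on_bounded_linear:
  assumes "open S" "bounded_linear f"
  shows "Ck_on k f S"
proof (cases k)
  case 0
  then show ?thesis using assms(2) by (simp add: linear_continuous_on)
next
  case (Suc n)
  show ?thesis unfolding Suc
    by (rule Ck_on_SucI[where f' = "\<lambda>x. f"])
      (auto simp: assms Ck_on_const bounded_linear.has_derivative intro: bounded_linear_imp_has_derivative)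
qed

lemma Ck_on_add:
  assumes "open S" "Ck_on k f S" "Ck_on k g S"
  shows "Ck_on k (\<lambda>x. f x + g x) S"
  using assms(2,3)
proof (induction k arbitrary: f g)
  case (Suc k)
  show ?case
  proof (rule Ck_on_SucI[OF assms(1)])
    show "((\<lambda>x. f x + g x) has_derivative
        (\<lambda>v. frechet_derivative f (at x) v + frechet_derivative g (at x) v)) (at x)" if "x \<in> S" for x
      using Suc.prems assms(1) that by (intro has_derivative_add Ck_on_SucD)
    show "Ck_on k (\<lambda>x. frechet_derivative f (at x) v + frechet_derivative g (at x) v) S" for v
      using Suc.prems by (intro Suc.IH) auto
  qed
qed (auto intro: continuous_intros)

lemma Ck_on_mult:
  assumes "open S" "Ck_on k f S" "Ck_on k g S"
  shows "Ck_on k (\<lambda>x. f x * g x) S"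
  using assms(2,3)
proof (induction k arbitrary: f g)
  case (Suc k)
  show ?case
  proof (rule Ck_on_SucI[OF assms(1)])
    show "((\<lambda>x. f x * g x) has_derivative
        (\<lambda>v. f x * frechet_derivative g (at x) v + frechet_derivative f (at x) v * g x)) (at x)"
      if "x \<in> S" for x
      using Suc.prems assms(1) that by (intro has_derivative_mult Ck_on_SucD)
    show "Ck_on k (\<lambda>x. f x * frechet_derivative g (at x) v + frechet_derivative f (at x) v * g x) S" for v
      using Suc.prems Ck_on_Suc_imp[OF Suc.prems(1)] Ck_on_Suc_imp[OF Suc.prems(2)]
      by (intro Ck_on_add assms(1) Suc.IH) auto
  qed
qed (auto intro: continuous_intros)

text \<open>The derivative of \<open>1/f\<close> is a polynomial in \<open>1/f\<close> and the
  derivative of \<open>f\<close>, so each order of differentiability of the inverse feeds the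
  next.\<close>

lemma Ck_on_inverse:
  assumes "open S" "Ck_on k f S" "\<And>x. x \<in> S \<Longrightarrow> f x \<noteq> 0"
  shows "Ck_on k (\<lambda>x. inverse (f x)) S"
  using assms(2)
proof (induction k)
  case 0
  then show ?case using assms(3) by (auto intro!: continuous_intros)
next
  case (Suc k)
  have inv: "Ck_on k (\<lambda>x. inverse (f x)) S"
    using Suc.IH Ck_on_Suc_imp[OF Suc.prems] .
  show ?case
  proof (rule Ck_on_SucI[OF assms(1)])
    show "((\<lambda>x. inverse (f x)) has_derivative
        (\<lambda>v. - 1 * (inverse (f x) * frechet_derivative f (at x) v * inverse (f x)))) (at x)"
      if "x \<in> S" for x
      using Deriv.has_derivative_inverse[OF assms(3)[OF that] Ck_on_SucD[OF Suc.prems assms(1) that]]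
      by simp
    show "Ck_on k (\<lambda>x. - 1 * (inverse (f x) * frechet_derivative f (at x) v * inverse (f x))) S" for v
      using Suc.prems by (intro Ck_on_mult Ck_on_const assms(1) inv) auto
  qed
qed

lemma smooth_on_cong:
  assumes "open S" "smooth_on f S" "\<And>x. x \<in> S \<Longrightarrow> f x = g x"
  shows "smooth_on g S"
  using Ck_on_cong[OF assms(1) _ assms(3)] assms(2) by (auto simp: smooth_on_def)

lemma smooth_on_diff:
  assumes "open S" "smooth_on f S" "smooth_on g S"
  shows "smooth_on (\<lambda>x. f x - g x) S"
proof -
  have "Ck_on k (\<lambda>x. f x + - 1 * g x) S" for k
    using assms by (intro Ck_on_add Ck_on_mult Ck_on_const) (auto simp: smooth_on_def)
  then show ?thesis by (simp add: smooth_on_def)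
qed

lemma smooth_on_frechet_derivative:
  assumes "smooth_on f S"
  shows "smooth_on (\<lambda>x. frechet_derivative f (at x) v) S"
  unfolding smooth_on_def using assms Ck_on.simps(2) by (metis smooth_on_def)

lemma smooth_on_has_derivative:
  assumes "smooth_on f S" "open S" "x \<in> S"
  shows "(f has_derivative frechet_derivative f (at x)) (at x)"
  using Ck_on_SucD assms by (metis smooth_on_def)

lemma smooth_on_continuous_on: "smooth_on f S \<Longrightarrow> continuous_on S f"
  by (metis smooth_on_def Ck_on.simps(1))

lemma smooth_on_inner_self: "smooth_on (\<lambda>x. x \<bullet> x) S" if "open S"
proof -
  have "Ck_on (Suc k) (\<lambda>x. x \<bullet> x) S" for k
  proof (rule Ck_on_SucI[OF that])
    show "((\<lambda>x. x \<bullet> x) has_derivative (\<lambda>v. x \<bullet> v + v \<bullet> x)) (at x)" for x :: 'a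
      by (intro derivative_eq_intros) auto
    show "Ck_on k (\<lambda>x. x \<bullet> v + v \<bullet> x) S" for v
      by (intro Ck_on_add that Ck_on_bounded_linear bounded_linear_inner_left bounded_linear_inner_right)
  qed
  then show ?thesis unfolding smooth_on_def by (blast intro: Ck_on_Suc_imp)
qed

text \<open>Two applications of the mean value theorem. The left-hand side of the equation is symmetric
  in \<open>v\<close> and \<open>w\<close>, whence the symmetry of the second derivative as \<open>s\<close> tends to 0.\<close>

lemma double_difference_mvt:
  fixes F :: "'a::euclidean_space \<Rightarrow> real"
  assumes "smooth_on F S" "open S" "s > 0"
    and box: "\<And>p q. 0 \<le> p \<Longrightarrow> p \<le> s \<Longrightarrow> 0 \<le> q \<Longrightarrow> q \<le> s \<Longrightarrow> g + p *\<^sub>R v + q *\<^sub>R w \<in> S"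
  shows "\<exists>p q. 0 < p \<and> p < s \<and> 0 < q \<and> q < s \<and>
    F (g + s *\<^sub>R v + s *\<^sub>R w) - F (g + s *\<^sub>R v) - F (g + s *\<^sub>R w) + F g =
    s * s * frechet_derivative (\<lambda>x. frechet_derivative F (at x) v) (at (g + p *\<^sub>R v + q *\<^sub>R w)) w"
proof -
  let ?D = "\<lambda>x. frechet_derivative F (at x)"
  let ?G = "\<lambda>x. ?D x v"
  have F: "(F has_derivative ?D x) (at x)" if "x \<in> S" for x
    using smooth_on_has_derivative assms that by blast
  have G: "(?G has_derivative frechet_derivative ?G (at x)) (at x)" if "x \<in> S" for x
    using smooth_on_has_derivative smooth_on_frechet_derivative assms that by blast
  have lin: "frechet_derivative H (at x) (t *\<^sub>R y) = t * frechet_derivative H (at x) y"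
    if "(H has_derivative frechet_derivative H (at x)) (at x)" for H :: "'a \<Rightarrow> real" and x y t
    using has_derivative_bounded_linear[OF that]
    by (simp add: linear_simps)
  have box1: "g + p *\<^sub>R v \<in> S" if "0 \<le> p" "p \<le> s" for p
    using box[OF that, of 0] assms(3) by simp
  \<comment> \<open>\<open>\<phi>\<close> is the increment of \<open>F\<close> along
    \<open>w\<close>, as a function of the displacement along \<open>v\<close>;
    \<open>\<psi>\<close> below treats the increment along \<open>w\<close> that remains after the
    first mean value theorem.\<close>
  define \<phi> where "\<phi> t = F (g + t *\<^sub>R v + s *\<^sub>R w) - F (g + t *\<^sub>R v)" for t
  have \<phi>: "(\<phi> has_derivative (\<lambda>t. t * (?G (g + p *\<^sub>R v + s *\<^sub>R w) - ?G (g + p *\<^sub>R v)))) (at p)"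
    if "0 \<le> p" "p \<le> s" for p
  proof -
    have "(\<phi> has_derivative (\<lambda>t. ?D (g + p *\<^sub>R v + s *\<^sub>R w) (t *\<^sub>R v) - ?D (g + p *\<^sub>R v) (t *\<^sub>R v))) (at p)"
      unfolding \<phi>_def
      by (rule has_derivative_diff; rule has_derivative_compose[OF _ F])
        (use that assms(3) box1 box in \<open>auto intro!: derivative_eq_intros\<close>)
    then show ?thesis
      using that assms(3) box box1 by (simp add: lin F right_diff_distrib)
  qed
  obtain p where p: "0 < p" "p < s"
    "\<phi> s - \<phi> 0 = (s - 0) * (?G (g + p *\<^sub>R v + s *\<^sub>R w) - ?G (g + p *\<^sub>R v))"
    by (rule mvt[OF assms(3), of \<phi> "\<lambda>p t. t * (?G (g + p *\<^sub>R v + s *\<^sub>R w) - ?G (g + p *\<^sub>R v))"])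
      (auto intro!: \<phi> has_derivative_continuous_on[OF has_derivative_at_withinI[OF \<phi>]])
  define \<psi> where "\<psi> t = ?G (g + p *\<^sub>R v + t *\<^sub>R w)" for t
  have \<psi>: "(\<psi> has_derivative (\<lambda>t. t * frechet_derivative ?G (at (g + p *\<^sub>R v + q *\<^sub>R w)) w)) (at q)"
    if "0 \<le> q" "q \<le> s" for q
  proof -
    have "(\<psi> has_derivative (\<lambda>t. frechet_derivative ?G (at (g + p *\<^sub>R v + q *\<^sub>R w)) (t *\<^sub>R w))) (at q)"
      unfolding \<psi>_def
      by (rule has_derivative_compose[OF _ G])
        (use that p box in \<open>auto intro!: derivative_eq_intros\<close>)
    then show ?thesis using that p box by (simp add: lin G)
  qed
  obtain q where q: "0 < q" "q < s"
    "\<psi> s - \<psi> 0 = (s - 0) * frechet_derivative ?G (at (g + p *\<^sub>R v + q *\<^sub>R w)) w"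
    by (rule mvt[OF assms(3), of \<psi> "\<lambda>q t. t * frechet_derivative ?G (at (g + p *\<^sub>R v + q *\<^sub>R w)) w"])
      (auto intro!: \<psi> has_derivative_continuous_on[OF has_derivative_at_withinI[OF \<psi>]])
  have "\<phi> s - \<phi> 0 = s * s * frechet_derivative ?G (at (g + p *\<^sub>R v + q *\<^sub>R w)) w"
    using p(3) q(3) by (simp add: \<psi>_def)
  moreover have "\<phi> s - \<phi> 0 =
      F (g + s *\<^sub>R v + s *\<^sub>R w) - F (g + s *\<^sub>R v) - F (g + s *\<^sub>R w) + F g"
    by (simp add: \<phi>_def)
  ultimately show ?thesis using p q by auto
qed

text \<open>By \<open>double_difference_mvt\<close> one and the same double difference is
  \<open>s * s\<close> times either mixed derivative, each at a point near \<open>g\<close>. If the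
  two differed at \<open>g\<close>, continuity would keep them apart at all nearby points.\<close>

lemma frechet_derivative_commute:
  fixes F :: "'a::euclidean_space \<Rightarrow> real"
  assumes "smooth_on F S" "open S" "g \<in> S"
  shows "frechet_derivative (\<lambda>x. frechet_derivative F (at x) v) (at g) w =
    frechet_derivative (\<lambda>x. frechet_derivative F (at x) w) (at g) v" (is "?A v w g = ?A w v g")
proof (rule ccontr)
  assume ne: "?A v w g \<noteq> ?A w v g"
  define e where "e = dist (?A v w g) (?A w v g) / 2"
  have "e > 0" using ne by (simp add: e_def)
  have cont: "continuous (at g) (?A v w)" for v w
    using smooth_on_frechet_derivative[OF smooth_on_frechet_derivative[OF assms(1)]]
      smooth_on_continuous_on assms(2,3) continuous_on_eq_continuous_at by blast
  have "\<exists>d>0. \<forall>x. dist x g < d \<longrightarrow> dist (?A v w x) (?A v w g) < e" for v w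
    using cont[of v w] \<open>e > 0\<close> by (simp add: continuous_at_eps_delta)
  then obtain d1 d2 where d: "d1 > 0" "d2 > 0"
    "\<And>x. dist x g < d1 \<Longrightarrow> dist (?A v w x) (?A v w g) < e"
    "\<And>x. dist x g < d2 \<Longrightarrow> dist (?A w v x) (?A w v g) < e"
    by metis
  obtain r where r: "r > 0" "ball g r \<subseteq> S" using assms(2,3) openE by blast
  define \<rho> where "\<rho> = min r (min d1 d2)"
  have "\<rho> > 0" using r d by (simp add: \<rho>_def)
  \<comment> \<open>Scaled so that the parallelogram at \<open>g\<close> with sides
    \<open>s *\<^sub>R v\<close> and \<open>s *\<^sub>R w\<close> stays in the ball of radius
    \<open>\<rho>\<close>; the summand 1 covers \<open>v = w = 0\<close>.\<close>
  define s where "s = \<rho> / (norm v + norm w + 1)"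
  have den: "norm v + norm w + 1 > 0" by (simp add: add_nonneg_pos)
  have "s > 0" using \<open>\<rho> > 0\<close> den by (simp add: s_def)
  have near: "norm (p *\<^sub>R v + q *\<^sub>R w) < \<rho>" if "0 \<le> p" "p \<le> s" "0 \<le> q" "q \<le> s" for p q
  proof -
    have "norm (p *\<^sub>R v + q *\<^sub>R w) \<le> p * norm v + q * norm w"
      using norm_triangle_ineq[of "p *\<^sub>R v" "q *\<^sub>R w"] that by simp
    also have "\<dots> \<le> s * norm v + s * norm w"
      using that by (intro add_mono mult_right_mono) auto
    also have "\<dots> < s * (norm v + norm w + 1)"
      using \<open>s > 0\<close> by (simp add: algebra_simps)
    also have "\<dots> = \<rho>" using den by (simp add: s_def)
    finally show ?thesis .
  qed
  have dist: "dist (g + p *\<^sub>R v + q *\<^sub>R w) g < \<rho>" "dist (g + q *\<^sub>R w + p *\<^sub>R v) g < \<rho>"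
    if "0 \<le> p" "p \<le> s" "0 \<le> q" "q \<le> s" for p q
    using near[OF that] by (simp_all add: dist_norm algebra_simps)
  have box: "g + p *\<^sub>R v + q *\<^sub>R w \<in> S" "g + q *\<^sub>R w + p *\<^sub>R v \<in> S"
    if "0 \<le> p" "p \<le> s" "0 \<le> q" "q \<le> s" for p q
    using dist[OF that] r(2) by (auto simp: \<rho>_def dist_commute subset_eq)
  obtain p q where pq: "0 < p" "p < s" "0 < q" "q < s"
    "F (g + s *\<^sub>R v + s *\<^sub>R w) - F (g + s *\<^sub>R v) - F (g + s *\<^sub>R w) + F g =
      s * s * ?A v w (g + p *\<^sub>R v + q *\<^sub>R w)"
    using double_difference_mvt[OF assms(1,2) \<open>s > 0\<close>, of g v w] box by auto
  obtain p' q' where pq': "0 < p'" "p' < s" "0 < q'" "q' < s"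
    "F (g + s *\<^sub>R w + s *\<^sub>R v) - F (g + s *\<^sub>R w) - F (g + s *\<^sub>R v) + F g =
      s * s * ?A w v (g + p' *\<^sub>R w + q' *\<^sub>R v)"
    using double_difference_mvt[OF assms(1,2) \<open>s > 0\<close>, of g w v] box by auto
  have "s * s * ?A v w (g + p *\<^sub>R v + q *\<^sub>R w) = s * s * ?A w v (g + p' *\<^sub>R w + q' *\<^sub>R v)"
    using pq(5) pq'(5)[unfolded add.assoc[of g "s *\<^sub>R w"] add.commute[of "s *\<^sub>R w"]
        add.assoc[of g "s *\<^sub>R v", symmetric]] by linarith
  then have "?A v w (g + p *\<^sub>R v + q *\<^sub>R w) = ?A w v (g + p' *\<^sub>R w + q' *\<^sub>R v)"
    using \<open>s > 0\<close> by simp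
  moreover have "dist (?A v w (g + p *\<^sub>R v + q *\<^sub>R w)) (?A v w g) < e"
    using dist(1)[of p q] pq by (intro d(3)) (simp add: \<rho>_def)
  moreover have "dist (?A w v (g + p' *\<^sub>R w + q' *\<^sub>R v)) (?A w v g) < e"
    using dist(2)[of q' p'] pq' by (intro d(4)) (simp add: \<rho>_def)
  ultimately have "dist (?A v w g) (?A w v g) < e + e"
    using dist_triangle_less_add[of "?A v w g" "?A w v (g + p' *\<^sub>R w + q' *\<^sub>R v)" e "?A w v g" e]
    by (simp add: dist_commute)
  then show False by (simp add: e_def)
qed

subsection \<open>Exterior derivatives on the three-sphere\<close>

lemma mem_S3_iff: "g \<in> S3 \<longleftrightarrow> (a0 g)\<^sup>2 + (a1 g)\<^sup>2 + (b0 g)\<^sup>2 + (b1 g)\<^sup>2 = 1"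
  by (simp add: norm_eq_1 inner_vec_def sum_4 power2_eq_square)

lemma mem_tangent_iff:
  "v \<in> tangent g \<longleftrightarrow> a0 v * a0 g + a1 v * a1 g + b0 v * b0 g + b1 v * b1 g = 0"
  by (simp add: tangent_def inner_vec_def sum_4)

lemma S3_nonzero: "g \<in> S3 \<Longrightarrow> g \<noteq> 0"
  by auto

lemma sgn_S3: "g \<in> S3 \<Longrightarrow> sgn g = g"
  by (simp add: sgn_div_norm)

lemma sgn_sgn_vector: "sgn (sgn x) = sgn (x :: 'a::real_normed_vector)"
  by (cases "x = 0") (simp_all add: sgn_div_norm[of "sgn x"] norm_sgn)

lemma sgn_mem_S3: "x \<noteq> 0 \<Longrightarrow> sgn (x :: quat) \<in> S3"
  by (simp add: norm_sgn)

text \<open>The derivative is the orthogonal projection onto the complement of \<open>x\<close>,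
  divided by \<open>norm x\<close>.\<close>

lemma has_derivative_sgn:
  fixes x :: "'a::real_inner"
  assumes "x \<noteq> 0"
  shows "(sgn has_derivative (\<lambda>v. inverse (norm x) *\<^sub>R v - ((x \<bullet> v) * inverse (norm x) ^ 3) *\<^sub>R x)) (at x)"
proof -
  have "((\<lambda>x. inverse (norm x) *\<^sub>R x) has_derivative
      (\<lambda>v. inverse (norm x) *\<^sub>R v - ((x \<bullet> v) * inverse (norm x) ^ 3) *\<^sub>R x)) (at x)"
    using assms
    by (auto intro!: derivative_eq_intros has_derivative_norm
        simp: sgn_div_norm inner_commute power3_eq_cube divide_inverse algebra_simps fun_eq_iff)
  then show ?thesis by (simp add: sgn_div_norm[abs_def])
qed

text \<open>The radial part of the derivative of \<open>sgn\<close> contributes a multiple of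
  \<open>\<omega> x x = 0\<close>; the rest is scaled by \<open>inverse (norm x)\<close> once in
  each argument.\<close>

lemma pullback_sgn_bilinear:
  assumes "bilinear \<omega>" "\<And>x. \<omega> x x = 0" "x \<noteq> 0"
  shows "pullback sgn \<omega> x v = \<omega> x v * inverse (x \<bullet> x)"
proof -
  have "pullback sgn \<omega> x v = \<omega> (sgn x) (inverse (norm x) *\<^sub>R v - ((x \<bullet> v) * inverse (norm x) ^ 3) *\<^sub>R x)"
    using fun_cong[OF frechet_derivative_at[OF has_derivative_sgn[OF assms(3)]], of v]
    by (simp add: pullback_def)
  also have "\<dots> = inverse (norm x) * inverse (norm x) * \<omega> x v"
    using assms(2) by (simp add: sgn_div_norm bilinear_lmul[OF assms(1)] bilinear_rsub[OF assms(1)]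
        bilinear_rmul[OF assms(1)])
  also have "inverse (norm x) * inverse (norm x) = inverse (x \<bullet> x)"
    by (simp add: dot_square_norm power2_eq_square)
  finally show ?thesis by simp
qed

lemma bilinear_bounded_linear_left:
  fixes \<omega> :: "'a::euclidean_space \<Rightarrow> 'b::euclidean_space \<Rightarrow> real"
  assumes "bilinear \<omega>"
  shows "bounded_linear (\<lambda>x. \<omega> x v)"
  using assms by (simp add: bilinear_def linear_conv_bounded_linear)

lemma smooth_form_S3_bilinear:
  assumes "bilinear \<omega>" "\<And>x. \<omega> x x = 0"
  shows "smooth_form_S3 \<omega>"
proof -
  have op: "open (- {0 :: quat})" by auto
  have "smooth_on (\<lambda>x. pullback sgn \<omega> x v) (- {0})" for v
  proof (rule smooth_on_cong[OF op])
    show "smooth_on (\<lambda>x. \<omega> x v * inverse (x \<bullet> x)) (- {0})"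
      unfolding smooth_on_def
    proof (intro allI Ck_on_mult[OF op])
      show "Ck_on k (\<lambda>x. \<omega> x v) (- {0})" for k
        by (intro Ck_on_bounded_linear op bilinear_bounded_linear_left assms(1))
      show "Ck_on k (\<lambda>x. inverse (x \<bullet> x)) (- {0 :: quat})" for k
        using smooth_on_inner_self[OF op] by (intro Ck_on_inverse[OF op]) (auto simp: smooth_on_def)
    qed
    show "\<omega> x v * inverse (x \<bullet> x) = pullback sgn \<omega> x v" if "x \<in> - {0}" for x
      using pullback_sgn_bilinear[OF assms] that by simp
  qed
  then show ?thesis
    by (simp add: smooth_form_S3_def bilinear_radd[OF assms(1)] bilinear_rmul[OF assms(1)])
qed

lemma pullback_sgn_bilinear_has_derivative:
  assumes "bilinear \<omega>" "\<And>x. \<omega> x x = 0" "g \<in> S3"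
  shows "((\<lambda>x. pullback sgn \<omega> x w) has_derivative (\<lambda>v. \<omega> v w - 2 * (g \<bullet> v) * \<omega> g w)) (at g)"
proof -
  have "((\<lambda>x. \<omega> x w * inverse (x \<bullet> x)) has_derivative (\<lambda>v. \<omega> v w - 2 * (g \<bullet> v) * \<omega> g w)) (at g)"
    using assms(3) bounded_linear_imp_has_derivative[OF bilinear_bounded_linear_left[OF assms(1)], of w "at g"]
    by (auto intro!: derivative_eq_intros simp: norm_eq_1 inner_commute algebra_simps fun_eq_iff)
  then show ?thesis
  proof (rule has_derivative_transform_within_open[where s = "- {0}"])
    show "\<omega> x w * inverse (x \<bullet> x) = pullback sgn \<omega> x w" if "x \<in> - {0}" for x
      using pullback_sgn_bilinear[OF assms(1,2)] that by simp
  qed (use assms(3) in auto)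
qed

text \<open>On tangent vectors the derivative of the factor \<open>inverse (x \<bullet> x)\<close>
  vanishes, so only the linear dependence of \<open>\<omega>\<close> on its base point
  contributes.\<close>

lemma d1_bilinear:
  assumes "bilinear \<omega>" "\<And>x. \<omega> x x = 0" "g \<in> S3" "v \<in> tangent g" "w \<in> tangent g"
  shows "d1 \<omega> g v w = \<omega> v w - \<omega> w v"
  using assms(4,5) frechet_derivative_at[OF pullback_sgn_bilinear_has_derivative[OF assms(1-3)], symmetric]
  by (simp add: d1_def tangent_def inner_commute)

text \<open>Chain rule applied to \<open>sgn (sgn x) = sgn x\<close>.\<close>

lemma pullback_sgn_d0:
  assumes "smooth_fun_S3 f" "x \<noteq> 0"
  shows "pullback sgn (d0 f) x v = frechet_derivative (\<lambda>x. f (sgn x)) (at x) v"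
proof -
  let ?F = "\<lambda>x. f (sgn x)"
  have sx: "sgn x \<noteq> 0" using assms(2) by (simp add: sgn_zero_iff)
  have F: "(?F has_derivative frechet_derivative ?F (at (sgn x))) (at (sgn x))"
    using assms(1) sx by (intro smooth_on_has_derivative[of _ "- {0}"]) (auto simp: smooth_fun_S3_def)
  have s: "(sgn has_derivative frechet_derivative sgn (at x)) (at x)"
    using has_derivative_sgn[OF assms(2)] frechet_derivative_works differentiableI by blast
  have "((\<lambda>x. ?F (sgn x)) has_derivative
      (\<lambda>v. frechet_derivative ?F (at (sgn x)) (frechet_derivative sgn (at x) v))) (at x)"
    using has_derivative_compose[OF s F] .
  then have "(?F has_derivative
      (\<lambda>v. frechet_derivative ?F (at (sgn x)) (frechet_derivative sgn (at x) v))) (at x)"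
    by (simp add: sgn_sgn_vector)
  from fun_cong[OF frechet_derivative_at[OF this], of v] show ?thesis
    by (simp add: pullback_def d0_def)
qed

lemma d0_linear:
  assumes "smooth_fun_S3 f" "g \<in> S3"
  shows "linear (d0 f g)"
  unfolding d0_def using assms
  by (intro has_derivative_linear[OF smooth_on_has_derivative[of _ "- {0}"]]) (auto simp: smooth_fun_S3_def)

lemma smooth_form_S3_d0:
  assumes "smooth_fun_S3 f"
  shows "smooth_form_S3 (d0 f)"
proof -
  have "smooth_on (\<lambda>x. pullback sgn (d0 f) x v) (- {0})" for v
    using smooth_on_frechet_derivative[OF assms[unfolded smooth_fun_S3_def], of v]
    by (rule smooth_on_cong[rotated]) (auto simp: pullback_sgn_d0[OF assms])
  then show ?thesis
    by (simp add: smooth_form_S3_def linear_add[OF d0_linear[OF assms]] linear_scale[OF d0_linear[OF assms]])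
qed

lemma smooth_form_S3_diff:
  assumes "smooth_form_S3 \<omega>" "smooth_form_S3 \<eta>"
  shows "smooth_form_S3 (\<lambda>g v. \<omega> g v - \<eta> g v)"
  using assms by (auto simp: smooth_form_S3_def pullback_def algebra_simps intro!: smooth_on_diff)

lemma d1_diff:
  assumes "smooth_form_S3 \<omega>" "smooth_form_S3 \<eta>" "g \<in> S3"
  shows "d1 (\<lambda>g v. \<omega> g v - \<eta> g v) g v w = d1 \<omega> g v w - d1 \<eta> g v w"
proof -
  have der: "((\<lambda>x. pullback sgn \<omega> x v) has_derivative frechet_derivative (\<lambda>x. pullback sgn \<omega> x v) (at g)) (at g)"
    if "smooth_form_S3 \<omega>" for \<omega> v
    using that assms(3) by (intro smooth_on_has_derivative[of _ "- {0}"]) (auto simp: smooth_form_S3_def)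
  have "frechet_derivative (\<lambda>x. pullback sgn (\<lambda>g v. \<omega> g v - \<eta> g v) x v) (at g) =
      (\<lambda>u. frechet_derivative (\<lambda>x. pullback sgn \<omega> x v) (at g) u
        - frechet_derivative (\<lambda>x. pullback sgn \<eta> x v) (at g) u)" for v
    using frechet_derivative_at[OF has_derivative_diff[OF der[OF assms(1)] der[OF assms(2)]], symmetric]
    by (simp add: pullback_def)
  then show ?thesis by (simp add: d1_def)
qed

text \<open>After \<open>pullback_sgn_d0\<close> this is the symmetry of the second derivatives of
  \<open>f (sgn x)\<close>.\<close>

lemma d1_d0:
  assumes "smooth_fun_S3 f" "g \<in> S3"
  shows "d1 (d0 f) g v w = 0"
proof -
  let ?F = "\<lambda>x. f (sgn x)"
  have g: "g \<in> - {0}" and op: "open (- {0 :: quat})" using assms(2) by auto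
  have sm: "smooth_on ?F (- {0})" using assms(1) by (simp add: smooth_fun_S3_def)
  have "frechet_derivative (\<lambda>x. pullback sgn (d0 f) x v) (at g) =
      frechet_derivative (\<lambda>x. frechet_derivative ?F (at x) v) (at g)" for v
  proof -
    have "((\<lambda>x. pullback sgn (d0 f) x v) has_derivative
        frechet_derivative (\<lambda>x. frechet_derivative ?F (at x) v) (at g)) (at g)"
      using smooth_on_has_derivative[OF smooth_on_frechet_derivative[OF sm] op g] op g
      by (rule has_derivative_transform_within_open) (simp add: pullback_sgn_d0[OF assms(1)])
    then show ?thesis by (rule frechet_derivative_at[symmetric])
  qed
  then show ?thesis
    using frechet_derivative_commute[OF sm op g] by (simp add: d1_def)
qed

subsection \<open>Maurer--Cartan forms and the dual frame\<close>

lemma bilinear_\<alpha>: "bilinear \<alpha>1" "bilinear \<alpha>2" "bilinear \<alpha>3"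
  by (auto simp: bilinear_def \<alpha>1_def \<alpha>2_def \<alpha>3_def algebra_simps intro!: linearI)

lemma \<alpha>_self: "\<alpha>1 x x = 0" "\<alpha>2 x x = 0" "\<alpha>3 x x = 0"
  by (auto simp: \<alpha>1_def \<alpha>2_def \<alpha>3_def)

text \<open>\<open>E1\<close>, \<open>E2\<close>, \<open>E3\<close> are the right-invariant fields \<open>j g\<close>, \<open>k g\<close>, \<open>i g\<close>; they are twice the frame
  dual to \<open>\<alpha>1\<close>, \<open>\<alpha>2\<close>, \<open>\<alpha>3\<close>.\<close>

definition E1 :: "quat \<Rightarrow> quat" where "E1 g = qmul (vector [0, 0, 1, 0]) g"
definition E2 :: "quat \<Rightarrow> quat" where "E2 g = qmul (vector [0, 0, 0, 1]) g"
definition E3 :: "quat \<Rightarrow> quat" where "E3 g = qmul (vector [0, 1, 0, 0]) g"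

lemmas E_defs = E1_def E2_def E3_def

lemma E_tangent: "E1 g \<in> tangent g" "E2 g \<in> tangent g" "E3 g \<in> tangent g"
  by (simp_all add: mem_tangent_iff E_defs qmul_def)

lemma \<alpha>_E:
  assumes "g \<in> S3"
  shows "\<alpha>1 g (E1 g) = 2" "\<alpha>1 g (E2 g) = 0" "\<alpha>1 g (E3 g) = 0"
    "\<alpha>2 g (E1 g) = 0" "\<alpha>2 g (E2 g) = 2" "\<alpha>2 g (E3 g) = 0"
    "\<alpha>3 g (E1 g) = 0" "\<alpha>3 g (E2 g) = 0" "\<alpha>3 g (E3 g) = 2"
  using assms unfolding mem_S3_iff
  by (simp_all add: E_defs qmul_def \<alpha>1_def \<alpha>2_def \<alpha>3_def power2_eq_square algebra_simps)

text \<open>\<open>\<alpha>1 g v\<close> is twice the inner product of \<open>v\<close> with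
  \<open>E1 g\<close>, likewise for the other two, and \<open>g\<close>, \<open>E1 g\<close>,
  \<open>E2 g\<close>, \<open>E3 g\<close> are orthonormal.\<close>

lemma tangent_expansion:
  assumes "g \<in> S3" "v \<in> tangent g"
  shows "v = (\<alpha>1 g v / 2) *\<^sub>R E1 g + (\<alpha>2 g v / 2) *\<^sub>R E2 g + (\<alpha>3 g v / 2) *\<^sub>R E3 g"
  using assms unfolding mem_S3_iff mem_tangent_iff
  by (simp add: vec_eq_iff forall_4 E_defs qmul_def \<alpha>1_def \<alpha>2_def \<alpha>3_def) (intro conjI; algebra)

text \<open>\<open>d1_bilinear\<close> turns each left-hand side into an antisymmetrized bilinear
  expression in \<open>v\<close> and \<open>w\<close>, which is evaluated on their expansions in the
  frame.\<close>

lemma maurer_cartan_equations: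
  assumes "g \<in> S3" "v \<in> tangent g" "w \<in> tangent g"
  shows "d1 \<alpha>1 g v w = wedge \<alpha>2 \<alpha>3 g v w"
    "d1 \<alpha>2 g v w = wedge \<alpha>3 \<alpha>1 g v w"
    "d1 \<alpha>3 g v w = wedge \<alpha>1 \<alpha>2 g v w"
proof -
  define p1 p2 p3 where "p1 = \<alpha>1 g v / 2" "p2 = \<alpha>2 g v / 2" "p3 = \<alpha>3 g v / 2"
  define q1 q2 q3 where "q1 = \<alpha>1 g w / 2" "q2 = \<alpha>2 g w / 2" "q3 = \<alpha>3 g w / 2"
  have v: "v = p1 *\<^sub>R E1 g + p2 *\<^sub>R E2 g + p3 *\<^sub>R E3 g"
    using tangent_expansion[OF assms(1,2)] by (simp add: p1_p2_p3_def)
  have w: "w = q1 *\<^sub>R E1 g + q2 *\<^sub>R E2 g + q3 *\<^sub>R E3 g"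
    using tangent_expansion[OF assms(1,3)] by (simp add: q1_q2_q3_def)
  have N: "a0 g * a0 g + a1 g * a1 g + b0 g * b0 g + b1 g * b1 g = 1"
    using assms(1) by (simp only: mem_S3_iff power2_eq_square)
  have pq: "\<alpha>1 g v = 2 * p1" "\<alpha>2 g v = 2 * p2" "\<alpha>3 g v = 2 * p3"
    "\<alpha>1 g w = 2 * q1" "\<alpha>2 g w = 2 * q2" "\<alpha>3 g w = 2 * q3"
    by (simp_all add: p1_p2_p3_def q1_q2_q3_def)
  \<comment> \<open>Keeping the squared norm of \<open>g\<close> as a factor makes these polynomial
    identities, valid without the constraint; \<open>N\<close> then sets the factor to 1.\<close>
  have *:
    "\<alpha>1 v w - \<alpha>1 w v = 4 * (p2 * q3 - q2 * p3) * (a0 g * a0 g + a1 g * a1 g + b0 g * b0 g + b1 g * b1 g)"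
    "\<alpha>2 v w - \<alpha>2 w v = 4 * (p3 * q1 - q3 * p1) * (a0 g * a0 g + a1 g * a1 g + b0 g * b0 g + b1 g * b1 g)"
    "\<alpha>3 v w - \<alpha>3 w v = 4 * (p1 * q2 - q1 * p2) * (a0 g * a0 g + a1 g * a1 g + b0 g * b0 g + b1 g * b1 g)"
    unfolding v w by (simp_all add: E_defs qmul_def \<alpha>1_def \<alpha>2_def \<alpha>3_def algebra_simps)
  note d1 = d1_bilinear[OF bilinear_\<alpha>(1) \<alpha>_self(1) assms] d1_bilinear[OF bilinear_\<alpha>(2) \<alpha>_self(2) assms]
    d1_bilinear[OF bilinear_\<alpha>(3) \<alpha>_self(3) assms]
  show "d1 \<alpha>1 g v w = wedge \<alpha>2 \<alpha>3 g v w"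
    "d1 \<alpha>2 g v w = wedge \<alpha>3 \<alpha>1 g v w"
    "d1 \<alpha>3 g v w = wedge \<alpha>1 \<alpha>2 g v w"
    unfolding d1 * N wedge_def pq by algebra+
qed

text \<open>The definite description is justified by evaluating on the frame: the coefficients can
  only be half the values of df on \<open>E1 g\<close>, \<open>E2 g\<close>, \<open>E3 g\<close>,
  and these work by \<open>tangent_expansion\<close>.\<close>

lemma alpha_deriv_works:
  assumes "smooth_fun_S3 f" "g \<in> S3" "v \<in> tangent g"
  shows "d0 f g v = alpha_deriv f g $ 1 * \<alpha>1 g v + alpha_deriv f g $ 2 * \<alpha>2 g v + alpha_deriv f g $ 3 * \<alpha>3 g v"
proof -
  let ?P = "\<lambda>c :: real ^ 3. \<forall>v\<in>tangent g. d0 f g v = c $ 1 * \<alpha>1 g v + c $ 2 * \<alpha>2 g v + c $ 3 * \<alpha>3 g v"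
  let ?c = "vector [d0 f g (E1 g) / 2, d0 f g (E2 g) / 2, d0 f g (E3 g) / 2] :: real ^ 3"
  note lin = linear_add[OF d0_linear[OF assms(1,2)]] linear_scale[OF d0_linear[OF assms(1,2)]]
  have "?P ?c"
  proof
    fix v assume "v \<in> tangent g"
    from arg_cong[OF tangent_expansion[OF assms(2) this], of "d0 f g"]
    show "d0 f g v = ?c $ 1 * \<alpha>1 g v + ?c $ 2 * \<alpha>2 g v + ?c $ 3 * \<alpha>3 g v"
      by (simp add: lin vector_3 mult.commute)
  qed
  moreover have "c = ?c" if "?P c" for c
    using that[rule_format, OF E_tangent(1)] that[rule_format, OF E_tangent(2)]
      that[rule_format, OF E_tangent(3)]
    by (simp add: vec_eq_iff forall_3 vector_3 \<alpha>_E[OF assms(2)])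
  ultimately have "?P (alpha_deriv f g)"
    unfolding alpha_deriv_def by (rule theI)
  then show ?thesis using assms(3) by blast
qed

lemma alpha_deriv_3:
  assumes "smooth_fun_S3 f" "g \<in> S3"
  shows "alpha_deriv f g $ 3 = d0 f g (E3 g) / 2"
  using alpha_deriv_works[OF assms E_tangent(3)] by (simp add: \<alpha>_E[OF assms(2)])

subsection \<open>The group of unit quaternions and invariance\<close>

lemma bilinear_qmul: "bilinear qmul"
  by (auto simp: bilinear_def vec_eq_iff forall_4 qmul_def algebra_simps intro!: linearI)

lemma bounded_linear_qmul: "bounded_linear (qmul p)" "bounded_linear (\<lambda>g. qmul g h)"
  using bilinear_qmul by (simp_all add: bilinear_def linear_conv_bounded_linear)

text \<open>Euler's four-square identity.\<close>

lemma norm_qmul: "norm (qmul p q) = norm p * norm q"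
proof -
  have "(norm (qmul p q))\<^sup>2 = (norm p * norm q)\<^sup>2"
    unfolding power_mult_distrib power2_norm_eq_inner
    by (simp add: qmul_def inner_vec_def sum_4 algebra_simps)
  then show ?thesis by (simp add: power2_eq_iff_nonneg)
qed

lemma qmul_S3: "p \<in> S3 \<Longrightarrow> q \<in> S3 \<Longrightarrow> qmul p q \<in> S3"
  by (simp add: norm_qmul)

lemma qmul_assoc: "qmul (qmul p q) r = qmul p (qmul q r)"
  by (simp add: vec_eq_iff forall_4 qmul_def algebra_simps)

lemma qmul_one: "qmul (vector [1, 0, 0, 0]) p = p" "qmul p (vector [1, 0, 0, 0]) = p"
  by (simp_all add: vec_eq_iff forall_4 qmul_def)

lemma qcnj_S3: "q \<in> S3 \<Longrightarrow> qcnj q \<in> S3"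
  unfolding mem_S3_iff by (simp add: qcnj_def)

lemma qmul_qcnj: "q \<in> S3 \<Longrightarrow> qmul (qcnj q) q = vector [1, 0, 0, 0]"
  unfolding mem_S3_iff
  by (simp add: vec_eq_iff forall_4 qmul_def qcnj_def power2_eq_square algebra_simps)

lemma cyc_gen_S3: "cyc_gen m \<in> S3"
  unfolding mem_S3_iff by (simp add: cyc_gen_def)

lemma group_SU2: "group SU2"
proof (rule groupI)
  show "\<exists>y\<in>carrier SU2. y \<otimes>\<^bsub>SU2\<^esub> x = \<one>\<^bsub>SU2\<^esub>" if "x \<in> carrier SU2" for x
    using that qmul_qcnj qcnj_S3 unfolding SU2_def by (intro bexI[of _ "qcnj x"]) auto
  \<comment> \<open>The neutral element is \<open>cyc_gen 1\<close>, already known to lie on the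
    sphere.\<close>
  show "\<one>\<^bsub>SU2\<^esub> \<in> carrier SU2"
    using cyc_gen_S3[of 1] by (simp add: SU2_def cyc_gen_def)
qed (simp_all add: SU2_def norm_qmul qmul_assoc qmul_one)

text \<open>Serves to pass from invariance under the generator to all of \<open>Cyc m\<close>.
  Inverses are handled by using invariance under \<open>h\<close> at the point
  \<open>qmul g (qcnj h)\<close>.\<close>

lemma subgroup_right_stabilizer:
  "subgroup {h \<in> S3. \<forall>g\<in>S3. f (qmul g h) = f g} SU2"
proof -
  interpret group SU2 by (rule group_SU2)
  show ?thesis
  proof (rule subgroupI)
    show "inv\<^bsub>SU2\<^esub> h \<in> {h \<in> S3. \<forall>g\<in>S3. f (qmul g h) = f g}"
      if h: "h \<in> {h \<in> S3. \<forall>g\<in>S3. f (qmul g h) = f g}" for h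
    proof -
      have inv: "inv\<^bsub>SU2\<^esub> h = qcnj h"
        using h qmul_qcnj qcnj_S3 by (intro inv_equality) (auto simp: SU2_def)
      have "f (qmul g (qcnj h)) = f g" if "g \<in> S3" for g
      proof -
        have "qmul g (qcnj h) \<in> S3" using that h qcnj_S3 qmul_S3 by blast
        then have "f (qmul (qmul g (qcnj h)) h) = f (qmul g (qcnj h))" using h by blast
        then show ?thesis using h by (simp add: qmul_assoc qmul_qcnj qmul_one)
      qed
      then show ?thesis unfolding inv using h qcnj_S3 by blast
    qed
    show "{h \<in> S3. \<forall>g\<in>S3. f (qmul g h) = f g} \<noteq> {}"
      using qmul_one(2) one_closed by (auto simp: SU2_def intro!: exI[of _ "vector [1, 0, 0, 0]"])
  qed (auto simp: SU2_def norm_qmul qmul_assoc[symmetric])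
qed

lemma Cyc_stabilizes:
  assumes "\<And>g. g \<in> S3 \<Longrightarrow> f (qmul g (cyc_gen m)) = f g"
  shows "Cyc m \<subseteq> {h \<in> S3. \<forall>g\<in>S3. f (qmul g h) = f g}"
  unfolding Cyc_def using assms cyc_gen_S3
  by (intro group.generate_subgroup_incl[OF group_SU2] subgroup_right_stabilizer) auto

section \<open>Forms under right translations\<close>

lemma pullback_qmul: "pullback (\<lambda>g. qmul g h) \<omega> g v = \<omega> (qmul g h) (qmul v h)"
  using frechet_derivative_at[OF bounded_linear_imp_has_derivative[OF bounded_linear_qmul(2)], symmetric]
  by (simp add: pullback_def)

text \<open>Replacing \<open>g\<close>, \<open>v\<close> by \<open>qmul g h\<close>,
  \<open>qmul v h\<close> multiplies \<open>qmul v (qcnj g)\<close>, whose components give the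
  forms, by \<open>h \<bullet> h\<close>, which is 1 on the sphere.\<close>

lemma \<alpha>_right_invariant:
  assumes "H \<subseteq> S3"
  shows "right_invariant_under H \<alpha>1" "right_invariant_under H \<alpha>2" "right_invariant_under H \<alpha>3"
proof -
  have "\<alpha>1 (qmul g h) (qmul v h) = (h \<bullet> h) * \<alpha>1 g v"
    "\<alpha>2 (qmul g h) (qmul v h) = (h \<bullet> h) * \<alpha>2 g v"
    "\<alpha>3 (qmul g h) (qmul v h) = (h \<bullet> h) * \<alpha>3 g v" for g h v
    by (simp_all add: qmul_def \<alpha>1_def \<alpha>2_def \<alpha>3_def inner_vec_def sum_4 algebra_simps)
  then show "right_invariant_under H \<alpha>1" "right_invariant_under H \<alpha>2" "right_invariant_under H \<alpha>3"
    using assms by (auto simp: right_invariant_under_def pullback_qmul norm_eq_1)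
qed

text \<open>Differentiates \<open>?F (qmul x h) = ?F x\<close>, which holds on the whole space
  because \<open>sgn\<close> commutes with multiplication by a unit quaternion.\<close>

lemma d0_right_invariant:
  assumes "smooth_fun_S3 f" "H \<subseteq> {h \<in> S3. \<forall>g\<in>S3. f (qmul g h) = f g}"
  shows "right_invariant_under H (d0 f)"
  unfolding right_invariant_under_def pullback_qmul
proof (intro ballI)
  fix h g v assume h: "h \<in> H" and g: "g \<in> S3"
  let ?F = "\<lambda>x. f (sgn x)"
  have hS: "h \<in> S3" using h assms(2) by blast
  have gh: "qmul g h \<in> - {0}" using qmul_S3[OF g hS] by auto
  have "?F (qmul x h) = ?F x" for x
  proof (cases "x = 0")
    case True
    then show ?thesis using norm_qmul[of 0 h] by simp
  next
    case False
    have "sgn (qmul x h) = qmul (sgn x) h"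
      using hS linear_scale[OF bounded_linear.linear[OF bounded_linear_qmul(2)]]
      by (simp add: sgn_div_norm norm_qmul)
    then show ?thesis using h assms(2) sgn_mem_S3[OF False] by auto
  qed
  moreover have "((\<lambda>x. ?F (qmul x h)) has_derivative (\<lambda>v. d0 f (qmul g h) (qmul v h))) (at g)"
    unfolding d0_def
    using gh assms(1)
    by (intro has_derivative_compose[OF bounded_linear_imp_has_derivative[OF bounded_linear_qmul(2)]]
        smooth_on_has_derivative[of _ "- {0}"]) (auto simp: smooth_fun_S3_def)
  ultimately have "(?F has_derivative (\<lambda>v. d0 f (qmul g h) (qmul v h))) (at g)"
    by simp
  from fun_cong[OF frechet_derivative_at[OF this], of v]
  show "d0 f (qmul g h) (qmul v h) = d0 f g v" by (simp add: d0_def)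
qed

lemma right_invariant_diff:
  assumes "right_invariant_under H \<omega>" "right_invariant_under H \<eta>"
  shows "right_invariant_under H (\<lambda>g v. \<omega> g v - \<eta> g v)"
  using assms by (simp add: right_invariant_under_def pullback_def)

section \<open>Continuity and density on the sphere\<close>

lemma smooth_fun_S3_continuous_on:
  assumes "smooth_fun_S3 f"
  shows "continuous_on S3 f"
proof -
  have "continuous_on S3 (\<lambda>x. f (sgn x))"
    using smooth_on_continuous_on[OF assms[unfolded smooth_fun_S3_def]]
    by (rule continuous_on_subset) auto
  then show ?thesis by (rule continuous_on_eq) (simp only: sgn_S3)
qed

text \<open>Each zero of the quadratic form \<open>a0 b1 - a1 b0\<close> on the sphere is a limit of
  points of the sphere where the form does not vanish.\<close>

lemma eq_on_S3_by_density:
  fixes f h :: "quat \<Rightarrow> real"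
  assumes "continuous_on S3 f" "continuous_on S3 h"
    and eq: "\<And>g. g \<in> S3 \<Longrightarrow> a0 g * b1 g - a1 g * b0 g \<noteq> 0 \<Longrightarrow> f g = h g"
    and g: "g \<in> S3"
  shows "f g = h g"
proof (cases "a0 g * b1 g - a1 g * b0 g = 0")
  case False
  then show ?thesis using eq g by blast
next
  case True
  \<comment> \<open>From a zero \<open>g\<close> of the form, a signed step \<open>s\<close> along
    \<open>y\<close> leads to the value \<open>s * (s + (a0 g + b1 g))\<close>; matching the sign of
    \<open>s\<close> to that of \<open>a0 g + b1 g\<close> excludes cancellation.\<close>
  define \<sigma> :: real where "\<sigma> = (if a0 g + b1 g \<ge> 0 then 1 else - 1)"
  define y :: quat where "y = vector [1, 0, 0, 1]"
  define X where "X n = g + (\<sigma> * inverse (real (Suc n))) *\<^sub>R y" for n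
  have Q: "a0 (X n) * b1 (X n) - a1 (X n) * b0 (X n) \<noteq> 0" for n
  proof -
    define s where "s = inverse (real (Suc n))"
    have "s > 0" by (simp add: s_def)
    have "a0 (X n) * b1 (X n) - a1 (X n) * b0 (X n) = (\<sigma> * s) * (\<sigma> * s + (a0 g + b1 g))"
      using True by (simp add: X_def y_def s_def algebra_simps)
    then show ?thesis using \<open>s > 0\<close> by (auto simp: \<sigma>_def)
  qed
  have X0: "X n \<noteq> 0" for n using Q[of n] by auto
  have S: "sgn (X n) \<in> S3" for n using sgn_mem_S3[OF X0] .
  have "X \<longlonglongrightarrow> g + (\<sigma> * 0) *\<^sub>R y"
    unfolding X_def by (intro tendsto_intros LIMSEQ_inverse_real_of_nat)
  then have "(\<lambda>n. sgn (X n)) \<longlonglongrightarrow> sgn g"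
    using S3_nonzero[OF g] by (intro tendsto_sgn) auto
  then have lim: "(\<lambda>n. sgn (X n)) \<longlonglongrightarrow> g" using sgn_S3[OF g] by simp
  have "f (sgn (X n)) = h (sgn (X n))" for n
  proof (rule eq[OF S])
    \<comment> \<open>The form is homogeneous of degree 2, so normalizing keeps it nonzero.\<close>
    have "a0 (sgn (X n)) * b1 (sgn (X n)) - a1 (sgn (X n)) * b0 (sgn (X n)) =
        inverse (norm (X n)) * inverse (norm (X n)) * (a0 (X n) * b1 (X n) - a1 (X n) * b0 (X n))"
      by (simp add: sgn_div_norm algebra_simps)
    then show "a0 (sgn (X n)) * b1 (sgn (X n)) - a1 (sgn (X n)) * b0 (sgn (X n)) \<noteq> 0"
      using Q X0 by simp
  qed
  then have "(\<lambda>n. f (sgn (X n))) \<longlonglongrightarrow> h g"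
    using continuous_on_tendsto_compose[OF assms(2) lim g] S by simp
  then show ?thesis
    using continuous_on_tendsto_compose[OF assms(1) lim g] S LIMSEQ_unique by fastforce
qed

text \<open>The orbit of \<open>g\<close> under left multiplication by exp(i t) has velocity
  \<open>E3 g\<close> at \<open>t = 0\<close>, and \<open>f\<close> is constant along it.\<close>

lemma d0_E3_eq_0:
  assumes "smooth_fun_S3 f" "g \<in> S3"
    and inv: "\<And>t. f (qmul (vector [cos t, sin t, 0, 0]) g) = f g"
  shows "d0 f g (E3 g) = 0"
proof -
  let ?F = "\<lambda>x. f (sgn x)"
  let ?\<gamma> = "\<lambda>t. cos t *\<^sub>R g + sin t *\<^sub>R E3 g"
  have \<gamma>: "?\<gamma> t = qmul (vector [cos t, sin t, 0, 0]) g" for t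
    by (simp add: vec_eq_iff forall_4 qmul_def E3_def algebra_simps)
  have "vector [cos t, sin t, 0, 0] \<in> S3" for t
    unfolding mem_S3_iff by simp
  then have const: "?F (?\<gamma> t) = f g" for t
    using inv sgn_S3[OF qmul_S3[OF _ assms(2)]] by (simp add: \<gamma>)
  have "(?\<gamma> has_derivative (\<lambda>t. t *\<^sub>R E3 g)) (at 0)"
    by (auto intro!: derivative_eq_intros)
  moreover have "(?F has_derivative d0 f g) (at (?\<gamma> 0))"
    unfolding d0_def using assms(1) S3_nonzero[OF assms(2)] sgn_S3[OF assms(2)] smooth_on_has_derivative[of ?F "- {0}" g]
    by (auto simp: smooth_fun_S3_def)
  ultimately have "((\<lambda>t. ?F (?\<gamma> t)) has_derivative (\<lambda>t. d0 f g (t *\<^sub>R E3 g))) (at 0)"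
    by (rule has_derivative_compose)
  then have "((\<lambda>t::real. f g) has_derivative (\<lambda>t. d0 f g (t *\<^sub>R E3 g))) (at 0)"
    by (simp only: const)
  then have "(\<lambda>t. d0 f g (t *\<^sub>R E3 g)) = (\<lambda>t. 0)"
    using has_derivative_const has_derivative_unique by blast
  from fun_cong[OF this, of 1] show ?thesis by simp
qed

subsection \<open>The generalized Finsler structure\<close>

text \<open>As df has no \<open>\<alpha>3\<close> component, substituting
  \<open>\<alpha>3 = df - \<omega>2\<close> into the equations for \<open>d \<alpha>1\<close> and
  \<open>d \<alpha>2\<close> produces the terms with \<open>I\<close> and \<open>J\<close>; the
  equation for \<open>d \<omega>2\<close> is that for \<open>- d \<alpha>3\<close>.\<close>

lemma gen_finsler_S3_of_first_integral:
  assumes f: "smooth_fun_S3 f" and 0: "\<And>g. g \<in> S3 \<Longrightarrow> d0 f g (E3 g) = 0"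
  shows "gen_finsler_S3 (f_\<alpha>1 f) (f_\<alpha>2 f) \<alpha>1 (\<lambda>g v. d0 f g v - \<alpha>3 g v) \<alpha>2"
proof -
  let ?\<omega>2 = "\<lambda>g v. d0 f g v - \<alpha>3 g v"
  have sm: "smooth_form_S3 \<alpha>1" "smooth_form_S3 \<alpha>2" "smooth_form_S3 \<alpha>3" "smooth_form_S3 (d0 f)"
    by (simp_all add: smooth_form_S3_bilinear bilinear_\<alpha> \<alpha>_self smooth_form_S3_d0 f)
  have df: "d0 f g v = f_\<alpha>1 f g * \<alpha>1 g v + f_\<alpha>2 f g * \<alpha>2 g v" if "g \<in> S3" "v \<in> tangent g" for g v
    using alpha_deriv_works[OF f that] alpha_deriv_3[OF f that(1)] 0[OF that(1)]
    by (simp add: f_\<alpha>1_def f_\<alpha>2_def)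
  \<comment> \<open>On \<open>E3 g\<close> only the \<open>\<alpha>3\<close> term survives, which
    forces \<open>c2 = 0\<close>; \<open>E1 g\<close> and \<open>E2 g\<close> then give the other
    two.\<close>
  have "c1 = 0 \<and> c2 = 0 \<and> c3 = 0"
    if g: "g \<in> S3" and c: "\<forall>v\<in>tangent g. c1 * \<alpha>1 g v + c2 * ?\<omega>2 g v + c3 * \<alpha>2 g v = 0" for g c1 c2 c3
    using c[rule_format, OF E_tangent(1)] c[rule_format, OF E_tangent(2)] c[rule_format, OF E_tangent(3)]
    by (simp add: \<alpha>_E[OF g] 0[OF g])
  then have "coframe_S3 \<alpha>1 ?\<omega>2 \<alpha>2"
    using sm smooth_form_S3_diff unfolding coframe_S3_def by blast
  moreover have "d1 ?\<omega>2 g v w = - d1 \<alpha>3 g v w" if "g \<in> S3" for g v w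
    using d1_diff[OF sm(4,3) that] d1_d0[OF f that] by simp
  ultimately show ?thesis
    by (simp add: gen_finsler_S3_def eq_form2_S3_def maurer_cartan_equations wedge_def df algebra_simps)
qed

theorem proposition6p4:
  fixes m :: nat and f :: "quat \<Rightarrow> real"
    and \<Phi>\<^sub>2 :: "real \<Rightarrow> real \<Rightarrow> real" and \<Phi>\<^sub>1 :: "real \<Rightarrow> real"
  assumes "m \<ge> 2"
    and "smooth_fun_S3 f"
    and "m = 2 \<Longrightarrow>
      \<forall>g\<in>S3. a0 g * b1 g - a1 g * b0 g \<noteq> 0 \<longrightarrow>
        f g = \<Phi>\<^sub>2 ((b0 g)\<^sup>2 + (b1 g)\<^sup>2)
                (arctan ((a0 g * b0 g + a1 g * b1 g) / (a0 g * b1 g - a1 g * b0 g)))"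
    and "m > 2 \<Longrightarrow> \<forall>g\<in>S3. f g = \<Phi>\<^sub>1 ((b0 g)\<^sup>2 + (b1 g)\<^sup>2)"
  defines "\<omega>1 \<equiv> \<alpha>1"
    and "\<omega>2 \<equiv> (\<lambda>g v. d0 f g v - \<alpha>3 g v)"
    and "\<omega>3 \<equiv> \<alpha>2"
  shows "gen_finsler_S3 (f_\<alpha>1 f) (f_\<alpha>2 f) \<omega>1 \<omega>2 \<omega>3 \<and> descends_mod_Cyc m \<omega>1 \<omega>2 \<omega>3"
proof -
  define u where "u t = (vector [cos t, sin t, 0, 0] :: quat)" for t
  let ?gen = "cyc_gen m"
  let ?Q = "\<lambda>g. a0 g * b1 g - a1 g * b0 g" and ?R = "\<lambda>g. a0 g * b0 g + a1 g * b1 g"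
    and ?N = "\<lambda>g. (b0 g)\<^sup>2 + (b1 g)\<^sup>2"
  have u: "u t \<in> S3" for t unfolding mem_S3_iff by (simp add: u_def)
  have gen: "?gen = u (2 * pi / real m)" by (simp add: u_def cyc_gen_def)
  \<comment> \<open>\<open>?R\<close> and \<open>- ?Q\<close> are the real and imaginary parts of
    \<open>z w\<^sup>*\<close>, and \<open>?N\<close> is the squared modulus of
    \<open>w\<close>.\<close>
  have left: "?N (qmul (u t) g) = ?N g" "?Q (qmul (u t) g) = ?Q g" "?R (qmul (u t) g) = ?R g" for t g
    unfolding qmul_def u_def vector_4 using sin_cos_squared_add[of t] by algebra+
  have right: "?N (qmul g (u t)) = ?N g" for t g
    unfolding qmul_def u_def vector_4 using sin_cos_squared_add[of t] by algebra
  \<comment> \<open>For \<open>m = 2\<close> the generator is -1, and quadratic forms are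
    even.\<close>
  have two: "?N (qmul g ?gen) = ?N g" "?Q (qmul g ?gen) = ?Q g" "?R (qmul g ?gen) = ?R g" if "m = 2" for g
    using that by (simp_all add: qmul_def cyc_gen_def)
  have cont: "continuous_on S3 f" using assms(2) by (rule smooth_fun_S3_continuous_on)
  \<comment> \<open>The left invariance yields \<open>d0 f g (E3 g) = 0\<close>, the right
    invariance the descent to the quotient.\<close>
  have inv: "f (qmul (u t) g) = f g \<and> f (qmul g ?gen) = f g" if g: "g \<in> S3" for t g
  proof (cases "m = 2")
    case True
    \<comment> \<open>The formula for \<open>f\<close> is only available where \<open>a0 b1 - a1 b0\<close> does not vanish.\<close>
    have ext: "f (L g) = f g"
      if "continuous_on S3 L" and L: "\<And>g. g \<in> S3 \<Longrightarrow> L g \<in> S3"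
        and inv: "\<And>g. ?N (L g) = ?N g" "\<And>g. ?Q (L g) = ?Q g" "\<And>g. ?R (L g) = ?R g" for L
    proof (rule eq_on_S3_by_density[OF _ cont _ g])
      show "continuous_on S3 (\<lambda>g. f (L g))"
        using L by (intro continuous_on_compose2[OF cont that(1)]) auto
      \<comment> \<open>\<open>L\<close> preserves \<open>?Q\<close>, so the formula for
        \<open>f\<close> applies at \<open>L g\<close> as well as at \<open>g\<close>, with equal
        arguments.\<close>
      show "f (L g) = f g" if "g \<in> S3" "?Q g \<noteq> 0" for g
        using assms(3)[OF True] that L[OF that(1)] inv[of g] by metis
    qed
    show ?thesis
      by (intro conjI ext left two True qmul_S3 u cyc_gen_S3 linear_continuous_on bounded_linear_qmul)
  next
    case False
    then have "m > 2" using assms(1) by simp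
    then show ?thesis
      using assms(4) g qmul_S3[OF u g, of t] qmul_S3[OF g u, of "2 * pi / real m"] left(1) right
      by (simp only: gen)
  qed
  have "d0 f g (E3 g) = 0" if "g \<in> S3" for g
    using inv[OF that] by (intro d0_E3_eq_0[OF assms(2) that]) (simp add: u_def)
  then have "gen_finsler_S3 (f_\<alpha>1 f) (f_\<alpha>2 f) \<omega>1 \<omega>2 \<omega>3"
    unfolding \<omega>1_def \<omega>2_def \<omega>3_def using assms(2) by (intro gen_finsler_S3_of_first_integral)
  moreover have "Cyc m \<subseteq> {h \<in> S3. \<forall>g\<in>S3. f (qmul g h) = f g}"
    using inv by (intro Cyc_stabilizes) blast
  then have "descends_mod_Cyc m \<omega>1 \<omega>2 \<omega>3"
    unfolding descends_mod_Cyc_def \<omega>1_def \<omega>2_def \<omega>3_def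
    by (intro conjI right_invariant_diff \<alpha>_right_invariant d0_right_invariant assms(2)) auto
  ultimately show ?thesis ..
qed

end
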